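(* Let $(X,X_+)$ be a finite-dimensional pre-Riesz space and assume that $X_+$ is closed. If $X$ is weakly pervasive, then $X$ is a vector lattice (and thus isomorphic, as an ordered vector space, to $\mathbb{R}^n$ with the standard order, where $n = \dim X$).
   Context: An ordered vector space $(X,X_+)$ is a real vector space $X$ with a non-empty set $X_+ \subseteq X$ such that $X_+ \cap (-X_+) = \{0\}$ and $\alpha X_+ + \beta X_+ \subseteq X_+$ for all $\alpha,\beta \in [0,\infty)$; one writes $x \le y$ if $y - x \in X_+$, and $[x,z] := \{y \in X : x \le y \le z\}$. It is a vector lattice if any two elements have a supremum and an infimum. It is a pre-Riesz space if for every non-empty finite set $A \subseteq X$ and every $x \in X$: if every upper bound of $x + A$ is an upper bound of $A$, then $x \in X_+$. Closedness in a finite-dimensional space is with respect to the usual (Euclidean) topology. The standard order on $\mathbb{R}^n$ is the one with positive cone $[0,\infty)^n$; an isomorphism of ordered vector spaces is a linear bijection mapping the positive cone of the first space onto that of the second. Two elements $x,y \in X$ are disjoint, $x \perp y$, if the sets $\{x+y,-x-y\}$ and $\{x-y,y-x\}$ have the same set of upper bounds in $X$ (for $x,y \in X_+$ this is equivalent to $\inf\{x,y\}$ existing in $X$ and being $0$). Two vectors $x,y \in X_+$ are D-disjoint if $[0,x] \cap [0,y] = \{0\}$. A pre-Riesz space $X$ is weakly pervasive if any two D-disjoint vectors in $X_+$ are disjoint. *)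

theory Defs
  imports "HOL-Analysis.Analysis"
begin

text \<open>An ordered vector space is a type of class \<open>real_vector\<close> together with its positive
  cone \<open>K\<close>; the order is a parameter, since it is not assumed to be an instance of \<open>order\<close>.\<close>

definition cone_le :: "'a::real_vector set \<Rightarrow> 'a \<Rightarrow> 'a \<Rightarrow> bool" where
  "cone_le K x y \<longleftrightarrow> y - x \<in> K"

definition ordered_vector_space :: "'a::real_vector set \<Rightarrow> bool" where
  "ordered_vector_space K \<longleftrightarrow>
     K \<noteq> {} \<and> K \<inter> uminus ` K = {0} \<and>
     (\<forall>\<alpha>\<ge>0. \<forall>\<beta>\<ge>0. \<forall>x\<in>K. \<forall>y\<in>K. \<alpha> *\<^sub>R x + \<beta> *\<^sub>R y \<in> K)"

definition order_interval :: "'a::real_vector set \<Rightarrow> 'a \<Rightarrow> 'a \<Rightarrow> 'a set" where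
  "order_interval K x z = {y. cone_le K x y \<and> cone_le K y z}"

definition upper_bounds :: "'a::real_vector set \<Rightarrow> 'a set \<Rightarrow> 'a set" where
  "upper_bounds K A = {u. \<forall>a\<in>A. cone_le K a u}"

definition lower_bounds :: "'a::real_vector set \<Rightarrow> 'a set \<Rightarrow> 'a set" where
  "lower_bounds K A = {l. \<forall>a\<in>A. cone_le K l a}"

definition is_supremum :: "'a::real_vector set \<Rightarrow> 'a set \<Rightarrow> 'a \<Rightarrow> bool" where
  "is_supremum K A s \<longleftrightarrow> s \<in> upper_bounds K A \<and> (\<forall>u\<in>upper_bounds K A. cone_le K s u)"

definition is_infimum :: "'a::real_vector set \<Rightarrow> 'a set \<Rightarrow> 'a \<Rightarrow> bool" where
  "is_infimum K A i \<longleftrightarrow> i \<in> lower_bounds K A \<and> (\<forall>l\<in>lower_bounds K A. cone_le K l i)"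

definition vector_lattice :: "'a::real_vector set \<Rightarrow> bool" where
  "vector_lattice K \<longleftrightarrow>
     ordered_vector_space K \<and>
     (\<forall>x y. (\<exists>s. is_supremum K {x, y} s) \<and> (\<exists>i. is_infimum K {x, y} i))"

definition pre_Riesz :: "'a::real_vector set \<Rightarrow> bool" where
  "pre_Riesz K \<longleftrightarrow>
     ordered_vector_space K \<and>
     (\<forall>A x. finite A \<and> A \<noteq> {} \<and> upper_bounds K ((\<lambda>a. x + a) ` A) \<subseteq> upper_bounds K A \<longrightarrow> x \<in> K)"

definition disjoint_elements :: "'a::real_vector set \<Rightarrow> 'a \<Rightarrow> 'a \<Rightarrow> bool" where
  "disjoint_elements K x y \<longleftrightarrow> upper_bounds K {x + y, - x - y} = upper_bounds K {x - y, y - x}"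

definition D_disjoint :: "'a::real_vector set \<Rightarrow> 'a \<Rightarrow> 'a \<Rightarrow> bool" where
  "D_disjoint K x y \<longleftrightarrow> x \<in> K \<and> y \<in> K \<and> order_interval K 0 x \<inter> order_interval K 0 y = {0}"

definition weakly_pervasive :: "'a::real_vector set \<Rightarrow> bool" where
  "weakly_pervasive K \<longleftrightarrow>
     pre_Riesz K \<and> (\<forall>x\<in>K. \<forall>y\<in>K. D_disjoint K x y \<longrightarrow> disjoint_elements K x y)"

definition finite_dimensional :: "'a::real_vector itself \<Rightarrow> bool" where
  "finite_dimensional _ \<longleftrightarrow> (\<exists>B::'a set. finite B \<and> span B = UNIV)"

text \<open>Since the dimension is a number here and not a type, \<open>\<real>\<^sup>n\<close> is the carrier of the
  library's \<open>Euclidean_space n\<close>, that is, the functions \<open>nat \<Rightarrow> real\<close> vanishing at every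
  index \<open>i \<ge> n\<close>; this includes \<open>n = 0\<close>. As \<open>nat \<Rightarrow> real\<close> is not an instance of \<open>real_vector\<close>,
  linearity is stated componentwise.\<close>

definition linear_iso_Rn :: "nat \<Rightarrow> ('a::real_vector \<Rightarrow> nat \<Rightarrow> real) \<Rightarrow> bool" where
  "linear_iso_Rn n \<phi> \<longleftrightarrow>
     bij_betw \<phi> UNIV (topspace (Euclidean_space n)) \<and> (\<forall>i. linear (\<lambda>x. \<phi> x i))"

definition standard_cone :: "nat \<Rightarrow> (nat \<Rightarrow> real) set" where
  "standard_cone n = {v \<in> topspace (Euclidean_space n). \<forall>i<n. 0 \<le> v i}"

text \<open>The Euclidean topology of a finite-dimensional space is the one transported from \<open>\<real>\<^sup>n\<close> by
  a linear bijection. The choice of \<open>\<phi>\<close> is immaterial because linear bijections of \<open>\<real>\<^sup>n\<close> are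
  homeomorphisms.\<close>

definition Euclidean_closed :: "'a::real_vector set \<Rightarrow> bool" where
  "Euclidean_closed S \<longleftrightarrow>
     (\<exists>\<phi>. linear_iso_Rn (dim (UNIV :: 'a set)) \<phi> \<and>
          closedin (Euclidean_space (dim (UNIV :: 'a set))) (\<phi> ` S))"

definition order_isomorphic_Rn :: "'a::real_vector set \<Rightarrow> nat \<Rightarrow> bool" where
  "order_isomorphic_Rn K n \<longleftrightarrow> (\<exists>\<phi>. linear_iso_Rn n \<phi> \<and> \<phi> ` K = standard_cone n)"

end

theory Submission
  imports Defs
begin

text \<open>A closed pointed cone \<open>K\<close> is generated by its extremal vectors. Two extremal vectors that are
  not proportional are D-disjoint, hence disjoint by weak pervasiveness. Since \<open>K\<close> is generating,
  some extremal vectors form a basis \<open>B\<close>. If an extremal \<open>e\<close> were proportional to no element of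
  \<open>B\<close>, moving the negative terms of its expansion to the other side would give
  \<open>e \<le> c\<^sub>1 b\<^sub>1 + \<dots> + c\<^sub>k b\<^sub>k\<close> with \<open>c\<^sub>i \<ge> 0\<close> and \<open>e\<close> disjoint from every \<open>c\<^sub>i b\<^sub>i\<close>,
  which forces \<open>e \<le> 0\<close>. So \<open>K\<close> is the cone generated by the basis \<open>B\<close>.\<close>

text \<open>The only trace of the topology in the cone arguments: \<open>K\<close> meets every line
  in a closed set of parameters. This keeps them free of coordinates.\<close>

definition line_closed :: "'a::real_vector set \<Rightarrow> bool" where
  "line_closed K \<longleftrightarrow> (\<forall>x y. closed {t::real. x + t *\<^sub>R y \<in> K})"

text \<open>The non-zero vectors on the extreme rays of \<open>K\<close>.\<close>

definition extremal :: "'a::real_vector set \<Rightarrow> 'a \<Rightarrow> bool" where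
  "extremal K e \<longleftrightarrow> e \<in> K \<and> e \<noteq> 0 \<and> (\<forall>y\<in>K. e - y \<in> K \<longrightarrow> (\<exists>c. y = c *\<^sub>R e))"

text \<open>For \<open>x\<close> in the cone \<open>K\<close>, this is the smallest face of
  \<open>K\<close> containing \<open>x\<close>.\<close>

definition generated_face :: "'a::real_vector set \<Rightarrow> 'a \<Rightarrow> 'a set" where
  "generated_face K x = {y \<in> K. \<exists>c\<ge>0. c *\<^sub>R x - y \<in> K}"

lemma cone_0: "ordered_vector_space K \<Longrightarrow> 0 \<in> K"
  unfolding ordered_vector_space_def by blast

lemma cone_add: "ordered_vector_space K \<Longrightarrow> x \<in> K \<Longrightarrow> y \<in> K \<Longrightarrow> x + y \<in> K"
  unfolding ordered_vector_space_def by (metis scaleR_one zero_le_one)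

lemma cone_scale: "ordered_vector_space K \<Longrightarrow> x \<in> K \<Longrightarrow> 0 \<le> c \<Longrightarrow> c *\<^sub>R x \<in> K"
  unfolding ordered_vector_space_def by (metis add.right_neutral order_refl scaleR_zero_left)

lemma cone_pointed: "ordered_vector_space K \<Longrightarrow> x \<in> K \<Longrightarrow> - x \<in> K \<Longrightarrow> x = 0"
  unfolding ordered_vector_space_def by (metis IntI imageI minus_minus singletonD)

lemma cone_sum:
  assumes "ordered_vector_space K" "\<And>i. i \<in> I \<Longrightarrow> f i \<in> K"
  shows "sum f I \<in> K"
  using assms(2) by (induction I rule: infinite_finite_induct)
    (auto simp: cone_0[OF assms(1)] cone_add[OF assms(1)])

section \<open>Generation of a closed cone by its extremal vectors\<close>

text \<open>The witness is the largest \<open>t\<close> with \<open>x - t *\<^sub>R y\<close> in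
  \<open>K\<close>. If the last conclusion failed for some \<open>c > 0\<close>, then
  \<open>t + 1/c\<close> would be admissible too; failure for \<open>c = 0\<close> contradicts
  pointedness.\<close>

lemma maximal_subtraction:
  assumes K: "ordered_vector_space K" and cl: "line_closed K"
    and x: "x \<in> K" and y: "y \<in> K" "y \<noteq> 0"
  obtains t where "0 \<le> t" "x - t *\<^sub>R y \<in> K" "\<And>c. 0 \<le> c \<Longrightarrow> c *\<^sub>R (x - t *\<^sub>R y) - y \<notin> K"
proof -
  define T where "T = {t. x - t *\<^sub>R y \<in> K}"
  have "closed {t. x + t *\<^sub>R (- y) \<in> K}" using cl unfolding line_closed_def by blast
  then have clT: "closed T" by (simp add: T_def)
  have 0: "0 \<in> T" using x by (simp add: T_def)
  have down: "s \<in> T" if "t \<in> T" "s \<le> t" for s t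
  proof -
    have "(x - t *\<^sub>R y) + (t - s) *\<^sub>R y \<in> K"
      using that K y by (intro cone_add cone_scale) (auto simp: T_def)
    then show ?thesis by (simp add: T_def algebra_simps)
  qed
  have bdd: "bdd_above T"
  proof (rule ccontr)
    assume "\<not> bdd_above T"
    then have all: "t \<in> T" for t
      using down unfolding bdd_above_def by (meson linear)
    \<comment> \<open>Rescaling by \<open>s = 1/t\<close> turns unboundedness of \<open>t\<close>
      into \<open>s\<close> tending to 0, where closedness along a line yields \<open>- y\<close> in
      \<open>K\<close>.\<close>
    have pos: "s *\<^sub>R x - y \<in> K" if "s > 0" for s :: real
    proof -
      have "s *\<^sub>R (x - (1/s) *\<^sub>R y) \<in> K"
        using all[of "1/s"] that K by (intro cone_scale) (auto simp: T_def)
      then show ?thesis using that by (simp add: scaleR_diff_right)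
    qed
    have "closed {s. - y + s *\<^sub>R x \<in> K}" using cl unfolding line_closed_def by blast
    moreover have "{0<..} \<subseteq> {s. - y + s *\<^sub>R x \<in> K}" using pos by auto
    ultimately have "closure {0<..} \<subseteq> {s. - y + s *\<^sub>R x \<in> K}"
      by (intro closure_minimal)
    then have "- y \<in> K" by (auto simp: subset_iff)
    then show False using cone_pointed[OF K y(1)] y(2) by blast
  qed
  have ST: "Sup T \<in> T" using closed_contains_Sup[OF _ bdd clT] 0 by blast
  show ?thesis
  proof
    show "0 \<le> Sup T" using 0 bdd by (rule cSup_upper)
    show "x - Sup T *\<^sub>R y \<in> K" using ST by (simp add: T_def)
    show "c *\<^sub>R (x - Sup T *\<^sub>R y) - y \<notin> K" if "0 \<le> c" for c
    proof
      assume *: "c *\<^sub>R (x - Sup T *\<^sub>R y) - y \<in> K"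
      show False
      proof (cases "c = 0")
        case True
        then show False using * cone_pointed[OF K y(1)] y(2) by simp
      next
        case False
        then have "(1/c) *\<^sub>R (c *\<^sub>R (x - Sup T *\<^sub>R y) - y) \<in> K"
          using * K that by (intro cone_scale) auto
        then have "Sup T + 1/c \<in> T"
          using False by (simp add: T_def algebra_simps)
        then have "Sup T + 1/c \<le> Sup T" using bdd by (rule cSup_upper)
        then show False using False that by simp
      qed
    qed
  qed
qed

text \<open>The vectors between \<open>- c *\<^sub>R x\<close> and \<open>c *\<^sub>R x\<close> for
  some \<open>c\<close> form a subspace containing the face, so domination by a multiple of
  \<open>x\<close> survives the passage to the span.\<close>

lemma span_generated_face_bounded:
  assumes K: "ordered_vector_space K" and x: "x \<in> K"
    and v: "v \<in> span (generated_face K x)"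
  obtains c where "0 \<le> c" "c *\<^sub>R x - v \<in> K"
proof -
  define S where "S = {v. \<exists>c\<ge>0. c *\<^sub>R x - v \<in> K \<and> c *\<^sub>R x + v \<in> K}"
  have "subspace S"
  proof (rule subspaceI)
    show "0 \<in> S" unfolding S_def using cone_0[OF K] by (auto intro: exI[of _ 0])
  next
    fix u w assume "u \<in> S" "w \<in> S"
    then obtain c d where cd: "c \<ge> 0" "c *\<^sub>R x - u \<in> K" "c *\<^sub>R x + u \<in> K"
      "d \<ge> 0" "d *\<^sub>R x - w \<in> K" "d *\<^sub>R x + w \<in> K" by (auto simp: S_def)
    have "(c + d) *\<^sub>R x - (u + w) \<in> K" "(c + d) *\<^sub>R x + (u + w) \<in> K"
      using cone_add[OF K cd(2,5)] cone_add[OF K cd(3,6)] by (simp_all add: algebra_simps)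
    then show "u + w \<in> S" using cd by (auto simp: S_def intro!: exI[of _ "c + d"])
  next
    fix a u assume "u \<in> S"
    then obtain c where c: "c \<ge> 0" "c *\<^sub>R x - u \<in> K" "c *\<^sub>R x + u \<in> K" by (auto simp: S_def)
    have "\<bar>a\<bar> *\<^sub>R (c *\<^sub>R x - u) \<in> K" "\<bar>a\<bar> *\<^sub>R (c *\<^sub>R x + u) \<in> K"
      using c K by (auto intro: cone_scale)
    moreover have "a *\<^sub>R u = \<bar>a\<bar> *\<^sub>R u \<or> a *\<^sub>R u = - (\<bar>a\<bar> *\<^sub>R u)" by (cases "a \<ge> 0") auto
    ultimately have "(\<bar>a\<bar> * c) *\<^sub>R x - a *\<^sub>R u \<in> K \<and> (\<bar>a\<bar> * c) *\<^sub>R x + a *\<^sub>R u \<in> K"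
      by (elim disjE)
        (simp_all add: scaleR_diff_right scaleR_add_right del: scaleR_cancel_right scaleR_minus_left)
    then show "a *\<^sub>R u \<in> S" using c by (auto simp: S_def intro!: exI[of _ "\<bar>a\<bar> * c"])
  qed
  moreover have "generated_face K x \<subseteq> S"
    unfolding generated_face_def S_def using cone_add[OF K] cone_scale[OF K x] by auto
  ultimately have "v \<in> S" using v span_minimal by blast
  then show ?thesis using that by (auto simp: S_def)
qed

lemma generated_face_mono:
  assumes K: "ordered_vector_space K" and "0 \<le> c" "c *\<^sub>R x - y \<in> K"
  shows "generated_face K y \<subseteq> generated_face K x"
proof
  fix u assume "u \<in> generated_face K y"
  then obtain d where d: "u \<in> K" "d \<ge> 0" "d *\<^sub>R y - u \<in> K" by (auto simp: generated_face_def)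
  have "d *\<^sub>R (c *\<^sub>R x - y) + (d *\<^sub>R y - u) \<in> K"
    using assms d by (intro cone_add cone_scale)
  then have "(d * c) *\<^sub>R x - u \<in> K" by (simp add: algebra_simps)
  then show "u \<in> generated_face K x" using d assms(2)
    by (auto simp: generated_face_def intro!: exI[of _ "d * c"])
qed

text \<open>The type is only of class \<open>real_vector\<close>, so the finite-dimensional locale
  is interpreted with a basis extracted from the finite spanning set.\<close>

lemma dim_psubset_finite_dimensional:
  fixes S T :: "'a::real_vector set"
  assumes fd: "finite_dimensional TYPE('a)" and "span S \<subset> span T"
  shows "dim S < dim T"
proof -
  obtain B0 :: "'a set" where B0: "finite B0" "span B0 = UNIV"
    using fd unfolding finite_dimensional_def by blast
  obtain B where B: "B \<subseteq> B0" "independent B" "B0 \<subseteq> span B"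
    using maximal_independent_subset by blast
  have "span B = UNIV" using B0 B by (metis span_mono span_span top.extremum_unique)
  then interpret fd: finite_dimensional_vector_space "scaleR :: real \<Rightarrow> 'a \<Rightarrow> 'a" B
    using B B0(1) finite_subset
    by unfold_locales (auto simp: dependent_raw_def span_raw_def algebra_simps)
  show ?thesis
    using fd.dim_psubset[of S T] assms(2) by (simp add: span_raw_def dim_raw_def)
qed

text \<open>Minkowski's theorem for cones, phrased as an induction rule so that it serves both
  membership in a span and nonnegativity of coordinates. The recursion is on the dimension of the
  face generated by \<open>x\<close>.\<close>

lemma extremal_induct [consumes 4, case_names zero extremal add scale]:
  fixes K :: "'a::real_vector set"
  assumes fd: "finite_dimensional TYPE('a)"
    and K: "ordered_vector_space K" and cl: "line_closed K" and "x \<in> K"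
    and zero: "P 0" and ext: "\<And>e. extremal K e \<Longrightarrow> P e"
    and add: "\<And>x y. P x \<Longrightarrow> P y \<Longrightarrow> P (x + y)"
    and scale: "\<And>c x. 0 \<le> c \<Longrightarrow> P x \<Longrightarrow> P (c *\<^sub>R x)"
  shows "P x"
  using \<open>x \<in> K\<close>
proof (induction "dim (generated_face K x)" arbitrary: x rule: less_induct)
  case less
  show ?case
  proof (cases "x = 0 \<or> extremal K x")
    case True
    then show ?thesis using zero ext by blast
  next
    case False
    then obtain y where y: "y \<in> K" "x - y \<in> K" "\<And>c. y \<noteq> c *\<^sub>R x" and x0: "x \<noteq> 0"
      using less.prems unfolding extremal_def by blast
    have y0: "y \<noteq> 0" using y(3)[of 0] by simp
    obtain t where t: "0 \<le> t" "x - t *\<^sub>R y \<in> K"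
      "\<And>c. 0 \<le> c \<Longrightarrow> c *\<^sub>R (x - t *\<^sub>R y) - y \<notin> K"
      using maximal_subtraction[OF K cl less.prems y(1) y0] by blast
    txt \<open>\<open>x\<close> is a nonnegative combination of \<open>z\<close> and \<open>w\<close>, each of which lies in the relative
      boundary of the face of \<open>x\<close> and hence generates a face of smaller dimension.\<close>
    define z where "z = x - t *\<^sub>R y"
    have z: "z \<in> K" using t by (simp add: z_def)
    have z0: "z \<noteq> 0"
    proof
      assume "z = 0"
      then have "x = t *\<^sub>R y" by (simp add: z_def)
      moreover have "t \<noteq> 0" using calculation x0 by auto
      ultimately have "y = (1/t) *\<^sub>R x" by simp
      then show False using y(3) by blast
    qed
    obtain s where s: "0 \<le> s" "y - s *\<^sub>R z \<in> K"
      "\<And>c. 0 \<le> c \<Longrightarrow> c *\<^sub>R (y - s *\<^sub>R z) - z \<notin> K"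
      using maximal_subtraction[OF K cl y(1) z z0] by blast
    define w where "w = y - s *\<^sub>R z"
    have w: "w \<in> K" using s by (simp add: w_def)
    have xz: "1 *\<^sub>R x - z \<in> K" using cone_scale[OF K y(1) t(1)] by (simp add: z_def)
    have xw: "1 *\<^sub>R x - w \<in> K"
      using cone_add[OF K y(2) cone_scale[OF K z s(1)]] by (simp add: w_def algebra_simps)
    have xy: "1 *\<^sub>R x - y \<in> K" using y by simp
    \<comment> \<open>The vector \<open>v\<close> certifies the drop in dimension: it lies in the
      face of \<open>x\<close>, but no multiple of \<open>u\<close> dominates it, so it is outside
      the span of the face of \<open>u\<close>.\<close>
    have smaller: "P u"
      if u: "u \<in> K" "1 *\<^sub>R x - u \<in> K" and v: "v \<in> K" "1 *\<^sub>R x - v \<in> K"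
        and uv: "\<And>c. 0 \<le> c \<Longrightarrow> c *\<^sub>R u - v \<notin> K" for u v
    proof -
      have "generated_face K u \<subseteq> generated_face K x"
        using generated_face_mono[OF K _ u(2)] by simp
      moreover have "v \<in> generated_face K x"
        using v unfolding generated_face_def by (auto intro!: exI[of _ 1])
      moreover have "v \<notin> span (generated_face K u)"
        using span_generated_face_bounded[OF K u(1)] uv by blast
      ultimately have "span (generated_face K u) \<subset> span (generated_face K x)"
        using span_mono span_base by blast
      then show "P u" using less.hyps u(1) dim_psubset_finite_dimensional[OF fd] by blast
    qed
    have "P z" by (rule smaller[OF z xz y(1) xy]) (simp add: z_def t)
    moreover have "P w" by (rule smaller[OF w xw z xz]) (simp add: w_def s)
    \<comment> \<open>Substitute \<open>y = w + s *\<^sub>R z\<close> into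
      \<open>x = z + t *\<^sub>R y\<close>.\<close>
    moreover have "x = (1 + t * s) *\<^sub>R z + t *\<^sub>R w"
      unfolding w_def by (simp add: z_def algebra_simps)
    ultimately show ?thesis using add scale t(1) s(1) by simp
  qed
qed

section \<open>From Euclidean closedness to closedness along lines\<close>

text \<open>In coordinates a line is a continuous map of its parameter, since each component is
  affine; the parameter set is the preimage of a closed set.\<close>

lemma Euclidean_closed_imp_line_closed:
  fixes K :: "'a::real_vector set"
  assumes "Euclidean_closed K"
  shows "line_closed K"
  unfolding line_closed_def
proof (intro allI)
  fix x y :: 'a
  let ?n = "dim (UNIV :: 'a set)"
  obtain \<phi> where bij: "bij_betw \<phi> UNIV (topspace (Euclidean_space ?n))"
    and lin: "\<And>i. linear (\<lambda>x. \<phi> x i)" and cl: "closedin (Euclidean_space ?n) (\<phi> ` K)"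
    using assms unfolding Euclidean_closed_def linear_iso_Rn_def by blast
  have "continuous_map euclideanreal (Euclidean_space ?n) (\<lambda>t. \<phi> (x + t *\<^sub>R y))"
    unfolding Euclidean_space_def continuous_map_in_subtopology continuous_map_componentwise_UNIV
  proof (intro conjI allI)
    fix i
    have "\<phi> (x + t *\<^sub>R y) i = \<phi> x i + t * \<phi> y i" for t
      using linear_add[OF lin] linear_cmul[OF lin] by simp
    then show "continuous_map euclideanreal euclideanreal (\<lambda>t. \<phi> (x + t *\<^sub>R y) i)"
      by (auto intro!: continuous_intros)
  next
    have "\<phi> v \<in> topspace (Euclidean_space ?n)" for v using bij by (simp add: bij_betw_apply)
    then show "(\<lambda>t. \<phi> (x + t *\<^sub>R y)) \<in> topspace euclideanreal \<rightarrow> {f. \<forall>i\<ge>?n. f i = 0}"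
      by (auto simp: topspace_Euclidean_space)
  qed
  from closedin_continuous_map_preimage[OF this cl]
  have "closed {t. \<phi> (x + t *\<^sub>R y) \<in> \<phi> ` K}" by simp
  moreover have "inj \<phi>" using bij by (simp add: bij_betw_def)
  ultimately show "closed {t. x + t *\<^sub>R y \<in> K}" by (simp add: inj_image_mem_iff)
qed

section \<open>Upper bounds and disjointness\<close>

text \<open>It suffices that \<open>{0, x}\<close> has an upper bound \<open>u\<close>, for then
  \<open>x = u - (u - x)\<close>.\<close>

lemma pre_Riesz_generating:
  assumes "pre_Riesz K"
  obtains u v where "u \<in> K" "v \<in> K" "x = u - v"
proof -
  have K: "ordered_vector_space K" using assms by (simp add: pre_Riesz_def)
  have "upper_bounds K {0, x} \<noteq> {}"
  proof
    assume empty: "upper_bounds K {0, x} = {}"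
    have "upper_bounds K ((\<lambda>a. x + a) ` {0, x}) = {}"
    proof (rule equals0I)
      fix u assume "u \<in> upper_bounds K ((\<lambda>a. x + a) ` {0, x})"
      then have "u - x \<in> upper_bounds K {0, x}"
        by (auto simp: upper_bounds_def cone_le_def algebra_simps)
      then show False using empty by blast
    qed
    \<comment> \<open>With no upper bounds on either side, the pre-Riesz inclusion for
      \<open>{0, x}\<close> holds vacuously.\<close>
    then have "x \<in> K"
      using assms unfolding pre_Riesz_def
      by (metis empty_subsetI finite.emptyI finite.insertI insert_not_empty)
    then have "x \<in> upper_bounds K {0, x}"
      using cone_0[OF K] by (simp add: upper_bounds_def cone_le_def)
    then show False using empty by blast
  qed
  then obtain u where "u \<in> K" "u - x \<in> K" by (auto simp: upper_bounds_def cone_le_def)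
  then show ?thesis using that[of u "u - x"] by simp
qed

text \<open>The vector \<open>x + y - 2 *\<^sub>R l\<close> dominates both \<open>x - y\<close> and
  \<open>y - x\<close>. By disjointness it dominates \<open>x + y\<close>, and halving the
  difference leaves \<open>- l\<close>.\<close>

lemma disjoint_elements_lower_bound:
  assumes K: "ordered_vector_space K" and xy: "x \<in> K" "y \<in> K" "disjoint_elements K x y"
    and l: "x - l \<in> K" "y - l \<in> K"
  shows "- l \<in> K"
proof -
  have *: "2 *\<^sub>R (x - l) \<in> K" "2 *\<^sub>R (y - l) \<in> K" using l K by (auto intro: cone_scale)
  have "x + y - 2 *\<^sub>R l \<in> upper_bounds K {x - y, y - x}"
    using * by (simp add: upper_bounds_def cone_le_def algebra_simps scaleR_2)
  then have "x + y - 2 *\<^sub>R l \<in> upper_bounds K {x + y, - x - y}"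
    using xy(3) by (simp add: disjoint_elements_def)
  then have "(1/2) *\<^sub>R ((x + y - 2 *\<^sub>R l) - (x + y)) \<in> K"
    using K by (intro cone_scale) (auto simp: upper_bounds_def cone_le_def)
  then show ?thesis by simp
qed

text \<open>Replaces the lattice fact that disjointness passes to sums, without using suprema. In
  the induction step \<open>l - f i\<close> is a lower bound of \<open>e\<close> and of the
  remaining sum, hence \<open>l\<close> lies below \<open>f i\<close> and \<open>disj\<close>
  applies.\<close>

lemma lower_bound_sum_nonpos:
  assumes K: "ordered_vector_space K" and e: "e \<in> K"
    and f: "\<And>i. i \<in> I \<Longrightarrow> f i \<in> K"
    and disj: "\<And>i l. i \<in> I \<Longrightarrow> e - l \<in> K \<Longrightarrow> f i - l \<in> K \<Longrightarrow> - l \<in> K"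
    and l: "e - l \<in> K" "sum f I - l \<in> K"
  shows "- l \<in> K"
  using f disj l
proof (induction I arbitrary: l rule: infinite_finite_induct)
  case (insert i I)
  have "- (l - f i) \<in> K"
  proof (rule insert.IH)
    have "(e - l) + f i \<in> K" using insert.prems by (intro cone_add[OF K]) auto
    then show "e - (l - f i) \<in> K" by (simp add: algebra_simps)
    show "sum f I - (l - f i) \<in> K" using insert by (simp add: algebra_simps)
  qed (use insert.prems in auto)
  then have "f i - l \<in> K" by simp
  then show ?case using insert.prems(2)[of i l] insert.prems(3) by blast
qed auto

section \<open>Coordinates of extremal vectors under weak pervasiveness\<close>

lemma extremal_scale:
  assumes K: "ordered_vector_space K" and e: "extremal K e" and c: "0 < c"
  shows "extremal K (c *\<^sub>R e)"
  unfolding extremal_def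
proof (intro conjI ballI impI)
  show "c *\<^sub>R e \<in> K" "c *\<^sub>R e \<noteq> 0" using e c cone_scale[OF K] by (auto simp: extremal_def)
  fix y assume y: "y \<in> K" "c *\<^sub>R e - y \<in> K"
  have "(1/c) *\<^sub>R y \<in> K" "(1/c) *\<^sub>R (c *\<^sub>R e - y) \<in> K"
    using y c by (auto intro!: cone_scale[OF K] simp del: scaleR_diff_right)
  then have "(1/c) *\<^sub>R y \<in> K" "e - (1/c) *\<^sub>R y \<in> K" using c by (simp_all add: scaleR_diff_right)
  then obtain d where "(1/c) *\<^sub>R y = d *\<^sub>R e" using e by (auto simp: extremal_def)
  then have "c *\<^sub>R (1/c) *\<^sub>R y = c *\<^sub>R d *\<^sub>R e" by simp
  then have "y = d *\<^sub>R (c *\<^sub>R e)" using c by (simp add: mult.commute)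
  then show "\<exists>d. y = d *\<^sub>R (c *\<^sub>R e)" by blast
qed

text \<open>A vector of \<open>K\<close> below both is a multiple of each; if non-zero, it would
  make \<open>e\<close> and \<open>f\<close> proportional.\<close>

lemma extremal_D_disjoint:
  assumes K: "ordered_vector_space K" and e: "extremal K e" and f: "extremal K f"
    and ef: "\<And>c. e \<noteq> c *\<^sub>R f"
  shows "D_disjoint K e f"
proof -
  have "y = 0" if y: "y \<in> K" "e - y \<in> K" "f - y \<in> K" for y
  proof (rule ccontr)
    assume y0: "y \<noteq> 0"
    obtain a where a: "y = a *\<^sub>R e" using e y unfolding extremal_def by blast
    obtain b where b: "y = b *\<^sub>R f" using f y unfolding extremal_def by blast
    from a have "a \<noteq> 0" using y0 by auto
    then have "e = (1/a) *\<^sub>R (a *\<^sub>R e)" by simp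
    also have "\<dots> = (1/a) *\<^sub>R (b *\<^sub>R f)" using a b by simp
    also have "\<dots> = (b/a) *\<^sub>R f" by simp
    finally show False using ef by blast
  qed
  then show ?thesis
    using e f cone_0[OF K]
    by (auto simp: D_disjoint_def order_interval_def cone_le_def extremal_def)
qed

text \<open>Here weak pervasiveness turns D-disjointness into disjointness. The case
  \<open>a = 0\<close> is separate because 0 is not extremal.\<close>

lemma extremal_scale_lower_bound:
  assumes wp: "weakly_pervasive K" and e: "extremal K e" and f: "extremal K f"
    and ef: "\<And>c. e \<noteq> c *\<^sub>R f" and a: "0 \<le> a"
    and l: "e - l \<in> K" "a *\<^sub>R f - l \<in> K"
  shows "- l \<in> K"
proof (cases "a = 0")
  case True
  then show ?thesis using l by simp
next
  case False
  have K: "ordered_vector_space K" using wp by (simp add: weakly_pervasive_def pre_Riesz_def)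
  have af: "extremal K (a *\<^sub>R f)" using extremal_scale[OF K f] a False by simp
  have "D_disjoint K e (a *\<^sub>R f)" using ef by (intro extremal_D_disjoint[OF K e af]) simp
  then have "disjoint_elements K e (a *\<^sub>R f)"
    using wp e af by (simp add: weakly_pervasive_def extremal_def)
  then show ?thesis
    using disjoint_elements_lower_bound[OF K _ _ _ l] e af unfolding extremal_def by blast
qed

text \<open>If \<open>e\<close> is a multiple of a basis vector, pointedness makes the factor
  nonnegative. Otherwise the expansion of \<open>e\<close> leads to a contradiction.\<close>

lemma extremal_representation_nonneg:
  assumes wp: "weakly_pervasive K" and fin: "finite B" and ind: "independent B"
    and span: "span B = UNIV" and B: "\<And>b. b \<in> B \<Longrightarrow> extremal K b" and e: "extremal K e"
  shows "0 \<le> representation B e b"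
proof (cases "\<exists>b'\<in>B. \<exists>c. e = c *\<^sub>R b'")
  case True
  have K: "ordered_vector_space K" using wp by (simp add: weakly_pervasive_def pre_Riesz_def)
  from True obtain b' c where b': "b' \<in> B" and c: "e = c *\<^sub>R b'" by blast
  have "c \<ge> 0"
  proof (rule ccontr)
    assume "\<not> c \<ge> 0"
    then have "(- c) *\<^sub>R b' \<in> K" using B[OF b'] by (intro cone_scale[OF K]) (auto simp: extremal_def)
    then have "- e \<in> K" using c by simp
    then show False using cone_pointed[OF K] e by (auto simp: extremal_def)
  qed
  moreover have "representation B e b = c * representation B b' b"
    using representation_scale[OF ind, of b' c] span c by simp
  ultimately show ?thesis using representation_basis[OF ind b'] by simp
next
  case False
  have K: "ordered_vector_space K" using wp by (simp add: weakly_pervasive_def pre_Riesz_def)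
  define r where "r = representation B e"
  define f where "f b = max 0 (r b) *\<^sub>R b" for b
  have r: "(\<Sum>b\<in>B. r b *\<^sub>R b) = e"
    unfolding r_def using sum_representation_eq[OF ind, of e B] span fin by simp
  have BK: "b \<in> K" if "b \<in> B" for b using B[OF that] by (simp add: extremal_def)
  \<comment> \<open>The sum of \<open>f\<close> is the positive part of the expansion of
    \<open>e\<close>, so its difference from \<open>e\<close> is the negative part, which lies in
    \<open>K\<close>.\<close>
  have "(\<Sum>b\<in>B. max 0 (- r b) *\<^sub>R b) \<in> K"
    using BK by (intro cone_sum[OF K] cone_scale[OF K]) auto
  also have "(\<Sum>b\<in>B. max 0 (- r b) *\<^sub>R b) = sum f B - e"
    unfolding r[symmetric] sum_subtractf[symmetric]
    by (intro sum.cong refl) (auto simp: f_def max_def)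
  finally have le: "sum f B - e \<in> K" .
  \<comment> \<open>Take \<open>e\<close> itself as the common lower bound of \<open>e\<close> and
    \<open>sum f B\<close>.\<close>
  have "- e \<in> K"
  proof (rule lower_bound_sum_nonpos[OF K, of e B f])
    show "e \<in> K" using e by (simp add: extremal_def)
    show "f b \<in> K" if "b \<in> B" for b using BK[OF that] by (auto simp: f_def intro: cone_scale[OF K])
    show "- l \<in> K" if "b \<in> B" "e - l \<in> K" "f b - l \<in> K" for b l
      using extremal_scale_lower_bound[OF wp e B[OF that(1)], of "max 0 (r b)" l] False that
      by (auto simp: f_def)
  qed (use le cone_0[OF K] in auto)
  then show ?thesis using cone_pointed[OF K] e by (auto simp: extremal_def)
qed

section \<open>Cones generated by a basis\<close>

lemma representation_sum_basis:
  assumes "finite B" "independent B" "span B = UNIV" "b \<in> B"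
  shows "representation B (\<Sum>b\<in>B. f b *\<^sub>R b) b = f b"
proof -
  have "representation B (\<Sum>b\<in>B. f b *\<^sub>R b) b = (\<Sum>b'\<in>B. representation B (f b' *\<^sub>R b') b)"
    using assms by (subst representation_sum) auto
  also have "\<dots> = (\<Sum>b'\<in>B. if b' = b then f b' else 0)"
    using assms by (intro sum.cong refl) (auto simp: representation_scale representation_basis)
  finally show ?thesis using assms by simp
qed

text \<open>The order is coordinatewise, so suprema and infima are given by \<open>max\<close> and
  \<open>min\<close> of the coordinates.\<close>

lemma vector_lattice_basis_cone:
  assumes K: "ordered_vector_space K"
    and B: "finite B" "independent B" "span B = UNIV"
    and K_eq: "K = {x. \<forall>b\<in>B. 0 \<le> representation B x b}"
  shows "vector_lattice K"
  unfolding vector_lattice_def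
proof (intro conjI allI K)
  have le: "cone_le K x y \<longleftrightarrow> (\<forall>b\<in>B. representation B x b \<le> representation B y b)" for x y
    using B by (auto simp: cone_le_def K_eq representation_diff)
  fix x y
  define g where "g h = (\<Sum>b\<in>B. h (representation B x b) (representation B y b) *\<^sub>R b)"
    for h :: "real \<Rightarrow> real \<Rightarrow> real"
  have g: "representation B (g h) b = h (representation B x b) (representation B y b)"
    if "b \<in> B" for h b
    unfolding g_def by (rule representation_sum_basis[OF B that])
  have "is_supremum K {x, y} (g max)" "is_infimum K {x, y} (g min)"
    by (auto simp: is_supremum_def is_infimum_def upper_bounds_def lower_bounds_def le g)
  then show "\<exists>s. is_supremum K {x, y} s" "\<exists>i. is_infimum K {x, y} i" by blast+
qed

lemma order_isomorphic_Rn_basis_cone: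
  assumes B: "finite B" "independent B" "span B = UNIV"
    and K_eq: "K = {x. \<forall>b\<in>B. 0 \<le> representation B x b}"
  shows "order_isomorphic_Rn K (card B)"
proof -
  obtain h where h: "bij_betw h {0..<card B} B"
    using ex_bij_betw_nat_finite[OF B(1)] by blast
  define k where "k = inv_into {0..<card B} h"
  have hB: "h i \<in> B" if "i < card B" for i using h that by (auto simp: bij_betw_def)
  have kh: "k (h i) = i" if "i < card B" for i
    using h that by (simp add: k_def bij_betw_inv_into_left)
  have hk: "k b < card B \<and> h (k b) = b" if "b \<in> B" for b
    using h that bij_betw_inv_into_right[OF h that] bij_betwE[OF bij_betw_inv_into[OF h]]
    by (auto simp: k_def)
  \<comment> \<open>Coordinates along the enumeration \<open>h\<close> of \<open>B\<close>, padded
    by 0 from index \<open>card B\<close> on, as the carrier of \<open>Euclidean_space\<close>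
    demands; \<open>\<psi>\<close> is the inverse there.\<close>
  define \<phi> where "\<phi> x i = (if i < card B then representation B x (h i) else 0)" for x i
  define \<psi> where "\<psi> v = (\<Sum>b\<in>B. v (k b) *\<^sub>R b)" for v :: "nat \<Rightarrow> real"
  have \<phi>_top: "\<phi> x \<in> topspace (Euclidean_space (card B))" for x
    by (simp add: topspace_Euclidean_space \<phi>_def)
  have \<psi>\<phi>: "\<psi> (\<phi> x) = x" for x
  proof -
    have "\<psi> (\<phi> x) = (\<Sum>b\<in>B. representation B x b *\<^sub>R b)"
      unfolding \<psi>_def by (intro sum.cong refl) (simp add: \<phi>_def hk)
    then show ?thesis using sum_representation_eq[OF B(2), of x B] B by simp
  qed
  have \<phi>\<psi>: "\<phi> (\<psi> v) = v" if "v \<in> topspace (Euclidean_space (card B))" for v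
    using that representation_sum_basis[OF B hB]
    by (auto simp: fun_eq_iff \<phi>_def \<psi>_def kh topspace_Euclidean_space)
  have bij: "bij_betw \<phi> UNIV (topspace (Euclidean_space (card B)))"
    by (rule bij_betw_byWitness[where f' = \<psi>]) (use \<psi>\<phi> \<phi>\<psi> \<phi>_top in auto)
  have lin: "linear (\<lambda>x. \<phi> x i)" for i
    using B by (intro linearI) (auto simp: \<phi>_def representation_add representation_scale)
  have mem: "x \<in> K \<longleftrightarrow> \<phi> x \<in> standard_cone (card B)" for x
    unfolding standard_cone_def K_eq using \<phi>_top hB hk by (force simp: \<phi>_def)
  have "\<phi> ` K = standard_cone (card B)"
  proof
    show "standard_cone (card B) \<subseteq> \<phi> ` K"
      using mem \<phi>\<psi> by (metis (no_types, lifting) image_eqI mem_Collect_eq standard_cone_def subsetI)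
  qed (use mem in auto)
  then show ?thesis using bij lin unfolding order_isomorphic_Rn_def linear_iso_Rn_def by blast
qed

theorem corollary4p14:
  fixes K :: "'a::real_vector set"
  assumes "finite_dimensional TYPE('a)"
    and "pre_Riesz K"
    and "Euclidean_closed K"
    and "weakly_pervasive K"
  shows "vector_lattice K \<and> order_isomorphic_Rn K (dim (UNIV :: 'a set))"
proof -
  have K: "ordered_vector_space K" using assms(2) by (simp add: pre_Riesz_def)
  note cl = Euclidean_closed_imp_line_closed[OF assms(3)]
  \<comment> \<open>A maximal independent set of extremal vectors; it spans the whole space because
    extremal vectors generate \<open>K\<close> and \<open>K\<close> generates the space.\<close>
  obtain B where B: "B \<subseteq> {e. extremal K e}" "independent B" "{e. extremal K e} \<subseteq> span B"
    using maximal_independent_subset by blast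
  have "x \<in> span B" if "x \<in> K" for x
    using assms(1) K cl that
    by (induction x rule: extremal_induct) (use B(3) in \<open>auto intro: span_zero span_add span_scale\<close>)
  then have span: "span B = UNIV"
    using pre_Riesz_generating[OF assms(2)] span_diff by (metis UNIV_eq_I)
  obtain B0 :: "'a set" where "finite B0" "span B0 = UNIV"
    using assms(1) unfolding finite_dimensional_def by blast
  then have fin: "finite B" using independent_span_bound[of B0 B] B(2) by auto
  have ext: "extremal K b" if "b \<in> B" for b using B(1) that by blast
  \<comment> \<open>Extremal vectors have nonnegative coordinates, which gives one inclusion by
    induction; the other holds because \<open>B\<close> lies in \<open>K\<close>.\<close>
  have K_eq: "K = {x. \<forall>b\<in>B. 0 \<le> representation B x b}"
  proof (intro subset_antisym subsetI CollectI)
    fix x assume "x \<in> K"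
    with assms(1) K cl show "\<forall>b\<in>B. 0 \<le> representation B x b"
    proof (induction x rule: extremal_induct)
      case (extremal e)
      then show ?case
        using extremal_representation_nonneg[OF assms(4) fin B(2) span ext] by blast
    qed (use B(2) span in \<open>auto simp: representation_zero representation_add representation_scale\<close>)
  next
    fix x assume x: "x \<in> {x. \<forall>b\<in>B. 0 \<le> representation B x b}"
    have "(\<Sum>b\<in>B. representation B x b *\<^sub>R b) \<in> K"
      using x ext by (intro cone_sum[OF K] cone_scale[OF K]) (auto simp: extremal_def)
    then show "x \<in> K" using sum_representation_eq[OF B(2), of x B] span fin by simp
  qed
  have "dim (UNIV :: 'a set) = card B" using dim_eq_card[OF _ B(2), of UNIV] span by simp
  then show ?thesis
    using vector_lattice_basis_cone[OF K fin B(2) span K_eq]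
      order_isomorphic_Rn_basis_cone[OF fin B(2) span K_eq] by simp
qed

end
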